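(* Every $4$-dimensional grid is equitably $4$-list arborable.
   Context: $P_n$ denotes the path on $n$ vertices and $\square$ the Cartesian product. A $4$-dimensional grid is $P_{n_1}\square P_{n_2}\square P_{n_3}\square P_{n_4}$ with every $n_i\ge 2$. A $k$-uniform list assignment $L$ for $G$ assigns to each vertex $v$ a set $L(v)$ of exactly $k$ colours; an $L$-colouring is a map $c$ with $c(v)\in L(v)$; it is equitable if every colour class has at most $\lceil |V(G)|/k\rceil$ vertices. $G$ is equitably $k$-list arborable if for every $k$-uniform list assignment $L$ there is an equitable $L$-colouring of $G$ in which every colour class induces an acyclic subgraph. *)

theory Defs
  imports Complex_Main "Graph_Theory.Graph_Theory"
begin

text \<open>
  Finite simple graphs are the instances of the locale \<^locale>\<open>pair_graph\<close>: every undirected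
  edge is represented by its two opposite arcs.
\<close>

definition path_graph :: "nat \<Rightarrow> nat pair_pre_digraph" where
  "path_graph n =
    \<lparr> pverts = {..<n},
      parcs = {(i, j). i < n \<and> j < n \<and> (j = Suc i \<or> i = Suc j)} \<rparr>"

definition cart_prod ::
  "'a pair_pre_digraph \<Rightarrow> 'b pair_pre_digraph \<Rightarrow> ('a \<times> 'b) pair_pre_digraph"
  (infixl \<open>\<box>\<close> 70) where
  "G \<box> H =
    \<lparr> pverts = pverts G \<times> pverts H,
      parcs = {((u, x), (v, y)) | u x v y.
        u = v \<and> u \<in> pverts G \<and> (x, y) \<in> parcs H \<or>
        (u, v) \<in> parcs G \<and> x = y \<and> x \<in> pverts H} \<rparr>"

lemma pair_graph_path_graph: "pair_graph (path_graph n)"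
proof
  show "finite (parcs (path_graph n))"
    by (rule finite_subset[of _ "{..<n} \<times> {..<n}"]) (auto simp: path_graph_def)
qed (auto simp: path_graph_def symmetric_def intro!: symI)

lemma pair_graph_cart_prod:
  assumes "pair_graph G" "pair_graph H"
  shows "pair_graph (G \<box> H)"
proof -
  interpret G: pair_graph G by fact
  interpret H: pair_graph H by fact
  have sub: "parcs (G \<box> H) \<subseteq> (pverts G \<times> pverts H) \<times> (pverts G \<times> pverts H)"
    by (auto simp: cart_prod_def dest: G.wellformed' H.wellformed')
  show ?thesis
  proof
    show "finite (pverts (G \<box> H))"
      by (simp add: cart_prod_def)
    show "finite (parcs (G \<box> H))"
      by (rule finite_subset[OF sub]) simp
    show "symmetric (with_proj (G \<box> H))"
      using G.sym_arcs H.sym_arcs by (auto simp: symmetric_def sym_def cart_prod_def)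
    show "fst e \<in> pverts (G \<box> H)" "snd e \<in> pverts (G \<box> H)" if "e \<in> parcs (G \<box> H)" for e
      using that by (auto simp: cart_prod_def dest: G.wellformed' H.wellformed')
    show "fst e \<noteq> snd e" if "e \<in> parcs (G \<box> H)" for e
      using that G.pair_no_loops H.pair_no_loops by (auto simp: cart_prod_def)
  qed
qed

text \<open>
  The library predicate \<^const>\<open>pre_digraph.cycle\<close> is a directed notion and also holds of the
  closed walk that traverses an edge forth and back. The cycles of an undirected simple graph are
  those of length at least 3, hence the library's \<^const>\<open>forest\<close> cannot be used here.
\<close>

definition acyclic_graph :: "('a, 'b) pre_digraph \<Rightarrow> bool" where
  "acyclic_graph G \<longleftrightarrow> \<not> (\<exists>p. pre_digraph.cycle G p \<and> 3 \<le> length p)"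

definition uniform_list_assignment ::
  "nat \<Rightarrow> 'a pair_pre_digraph \<Rightarrow> ('a \<Rightarrow> 'c set) \<Rightarrow> bool" where
  "uniform_list_assignment k G L \<longleftrightarrow> (\<forall>v \<in> pverts G. finite (L v) \<and> card (L v) = k)"

definition list_colouring ::
  "'a pair_pre_digraph \<Rightarrow> ('a \<Rightarrow> 'c set) \<Rightarrow> ('a \<Rightarrow> 'c) \<Rightarrow> bool" where
  "list_colouring G L c \<longleftrightarrow> (\<forall>v \<in> pverts G. c v \<in> L v)"

definition colour_class :: "'a pair_pre_digraph \<Rightarrow> ('a \<Rightarrow> 'c) \<Rightarrow> 'c \<Rightarrow> 'a set" where
  "colour_class G c x = {v \<in> pverts G. c v = x}"

definition equitable_colouring :: "nat \<Rightarrow> 'a pair_pre_digraph \<Rightarrow> ('a \<Rightarrow> 'c) \<Rightarrow> bool" where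
  "equitable_colouring k G c \<longleftrightarrow>
    (\<forall>x. int (card (colour_class G c x)) \<le> \<lceil>real (card (pverts G)) / real k\<rceil>)"

text \<open>
  The type argument fixes the type from which colours are drawn, since HOL cannot quantify over
  it inside the definition; theorems are stated for an arbitrary type.
\<close>

definition equitably_list_arborable ::
  "'c itself \<Rightarrow> nat \<Rightarrow> 'a pair_pre_digraph \<Rightarrow> bool" where
  "equitably_list_arborable (_ :: 'c itself) k G \<longleftrightarrow>
    (\<forall>L :: 'a \<Rightarrow> 'c set. uniform_list_assignment k G L \<longrightarrow>
      (\<exists>c. list_colouring G L c \<and> equitable_colouring k G c \<and>
        (\<forall>x. acyclic_graph (with_proj G \<restriction> colour_class G c x))))"

end

theory Submission
  imports Defs
begin

text \<open>
  A partial colouring may be extended by a block of four vertices of pairwise different colours,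
  provided that every new vertex has at most one neighbour of its own colour among the old ones:
  no monochromatic cycle arises, and the class sizes stay below the ceiling. The cells \<open>(i, j)\<close> are
  cut into \<open>2 \<times> 2\<close> squares, and for each \<open>(k, t)\<close> the four vertices above a square form a block; the
  blocks are coloured by decreasing coordinates. The corners then have at most \<open>2, 3, 3, 4\<close> coloured
  neighbours outside the block, hence at least \<open>3, 3, 3, 2\<close> available colours, and a block is stuck
  only if three of its corners are left with the same three colours, containing those of the fourth.
  In that case the neighbours in directions \<open>k\<close> and \<open>t\<close> of the lowest corner, which has no other
  coloured neighbours, have the same colour; since every block that is not stuck has several
  colourings, this can be prevented in advance. The cells that are not covered when a dimension is
  odd form a path, so that they account for a grid of smaller dimension; exchanging the roles of
  \<open>(i, j)\<close> and \<open>(k, t)\<close>, one finally arrives at a path.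
\<close>

section \<open>Choosing four different colours\<close>

text \<open>The colours forbidden to a new vertex with these coloured neighbours
  (\<open>None\<close> for a missing one): any other colour occurs on at most one of them.\<close>

definition twice :: "'c option \<Rightarrow> 'c option \<Rightarrow> 'c option \<Rightarrow> 'c option \<Rightarrow> 'c set" where
  "twice p q r s = {y. (p = Some y \<and> (q = Some y \<or> r = Some y \<or> s = Some y)) \<or>
    (q = Some y \<and> (r = Some y \<or> s = Some y)) \<or> (r = Some y \<and> s = Some y)}"

text \<open>Each forbidden colour uses up two of the four entries. The sharper bounds serve corners
  that lack a neighbour, since three entries can repeat only one colour.\<close>

lemma twice_bounds:
  shows finite_twice: "finite (twice p q r s)"
    and card_twice: "card (twice p q r s) \<le> 2"
    and card_twice_None1: "card (twice None q r s) \<le> 1"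
    and card_twice_None2: "card (twice p None r s) \<le> 1"
proof -
  have sub: "twice p q r s \<subseteq> set_option p \<union> set_option q \<union> set_option r \<union> set_option s" for p q r s :: "'a option"
    by (auto simp: twice_def)
  show fin: "finite (twice p q r s)" for p q r s :: "'a option"
    by (rule finite_subset[OF sub]) auto
  have le1: "card (twice p q r s) \<le> 1" if "p = None \<or> q = None" for p q r s :: "'a option"
    using that by (auto simp: card_le_Suc0_iff_eq[OF fin]) (auto simp: twice_def)
  show "card (twice None q r s) \<le> 1" "card (twice p None r s) \<le> 1"
    using le1 by blast+
  have "twice p q r s \<subseteq> set_option p \<union> twice None q r s"
    by (auto simp: twice_def)
  then have "card (twice p q r s) \<le> card (set_option p \<union> twice None q r s)"
    by (intro card_mono) (auto simp: fin)
  also have "\<dots> \<le> card (set_option p) + card (twice None q r s)"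
    by (rule card_Un_le)
  also have "\<dots> \<le> 2"
    using le1[of None q r s] by (cases p) auto
  finally show "card (twice p q r s) \<le> 2" .
qed

text \<open>If \<open>p\<close>, \<open>q\<close> lie in \<open>D\<close> and \<open>r\<close> is
  the third colour of \<open>M\<close>, four orders of \<open>M\<close> end in \<open>p\<close> or
  \<open>q\<close>: two with \<open>b = r\<close> and one each with \<open>b = p\<close> and
  \<open>b = q\<close>. Excluding \<open>b = z\<close> leaves at least two of them, and
  \<open>\<tau>\<close> rules out at most one.\<close>

lemma three_set_choice:
  assumes "card M = 3" "D \<subseteq> M" "card D \<ge> 2"
  shows "\<exists>b\<in>M. \<exists>c\<in>M. \<exists>d\<in>D. distinct [b, c, d] \<and> b \<noteq> z \<and> (b, c) \<noteq> \<tau>"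
proof -
  obtain D' where D': "D' \<subseteq> D" "card D' = 2"
    using assms(3) by (meson obtain_subset_with_card_n)
  then obtain p q where pq: "D' = {p, q}" "p \<noteq> q"
    by (meson card_2_iff)
  have fin: "finite M"
    using assms(1) by (simp add: card_ge_0_finite)
  have "card (M - {p, q}) = 1"
    using assms D' pq fin by (subst card_Diff_subset) auto
  then obtain r where "M - {p, q} = {r}"
    by (meson card_1_singletonE)
  then have r: "r \<in> M" "r \<noteq> p" "r \<noteq> q" "p \<in> M" "q \<in> M" "p \<in> D" "q \<in> D"
    using D' pq assms(2) by auto
  show ?thesis
  proof (cases "z = r")
    case True
    show ?thesis
    proof (cases "\<tau> = (p, r)")
      case True
      then show ?thesis
        using r pq(2) \<open>z = r\<close> by (intro bexI[of _ q] bexI[of _ r] bexI[of _ p]) auto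
    next
      case False
      then show ?thesis
        using r pq(2) \<open>z = r\<close> by (intro bexI[of _ p] bexI[of _ r] bexI[of _ q]) auto
    qed
  next
    case False
    show ?thesis
    proof (cases "\<tau> = (r, p)")
      case True
      then show ?thesis
        using r pq(2) False by (intro bexI[of _ r] bexI[of _ q] bexI[of _ p]) auto
    next
      case False
      then show ?thesis
        using r pq(2) \<open>z \<noteq> r\<close> by (intro bexI[of _ r] bexI[of _ p] bexI[of _ q]) auto
    qed
  qed
qed

text \<open>Choose \<open>d\<close> first. Then \<open>b\<close> and \<open>c\<close> can fail only
  if \<open>B\<close> and \<open>C\<close> have a single common colour outside
  \<open>{x, d}\<close>, that is, if both equal one three-element set containing \<open>x\<close>
  and \<open>d\<close>. When this happens for every \<open>d\<close> in \<open>D\<close> other than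
  \<open>x\<close>, all of \<open>D\<close> lies in that set.\<close>

lemma other_three_choice:
  assumes B: "card B \<ge> 3" and C: "card C \<ge> 3" and D: "card D \<ge> 2"
    and stuck: "\<not> (B = C \<and> card B = 3 \<and> D \<subseteq> B \<and> x \<in> B)"
  shows "\<exists>b\<in>B. \<exists>c\<in>C. \<exists>d\<in>D. distinct [x, b, c, d]"
proof -
  have pick: "\<exists>y\<in>A. y \<notin> F" if "card F < card A" "finite F" for A F :: "'a set"
    using that by (meson card_mono not_le subsetI)
  have two: "\<exists>b\<in>B. \<exists>c\<in>C. b \<noteq> c \<and> b \<notin> {x, d} \<and> c \<notin> {x, d}"
    if "\<not> (B = C \<and> card B = 3 \<and> d \<in> B \<and> x \<in> B)" for d
  proof (rule ccontr)
    assume "\<not> ?thesis"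
    then have no: "b = c" if "b \<in> B" "c \<in> C" "b \<notin> {x, d}" "c \<notin> {x, d}" for b c
      using that by blast
    have cc: "card {x, d} < 3" by (simp add: card_insert_if)
    obtain b where b: "b \<in> B" "b \<notin> {x, d}"
      using pick[of "{x, d}" B] B cc by auto
    obtain c where c: "c \<in> C" "c \<notin> {x, d}"
      using pick[of "{x, d}" C] C cc by auto
    have "b = c" using no[OF b(1) c(1) b(2) c(2)] .
    have "y = b" if "y \<in> B" "y \<notin> {x, d}" for y
      using no[OF that(1) c(1) that(2) c(2)] \<open>b = c\<close> by simp
    moreover have "y = b" if "y \<in> C" "y \<notin> {x, d}" for y
      using no[OF b(1) that(1) b(2) that(2)] by simp
    ultimately have "B \<subseteq> {b, x, d}" "C \<subseteq> {b, x, d}"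
      by blast+
    moreover have "card {b, x, d} \<le> 3"
      by (simp add: card_insert_if)
    ultimately have "B = {b, x, d}" "C = {b, x, d}"
      using B C card_seteq[of "{b, x, d}" B] card_seteq[of "{b, x, d}" C] by force+
    then show False
      using that \<open>card {b, x, d} \<le> 3\<close> B by auto
  qed
  show ?thesis
  proof (cases "\<exists>d\<in>D. d \<noteq> x \<and> \<not> (B = C \<and> card B = 3 \<and> d \<in> B \<and> x \<in> B)")
    case True
    then obtain d where "d \<in> D" "d \<noteq> x" "\<not> (B = C \<and> card B = 3 \<and> d \<in> B \<and> x \<in> B)"
      by blast
    then show ?thesis
      using two[of d] by fastforce
  next
    case False
    obtain d where "d \<in> D" "d \<noteq> x"
      using pick[of "{x}" D] D by auto
    then have "B = C" "card B = 3" "x \<in> B"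
      using False by blast+
    then have "D \<subseteq> B"
      using False \<open>x \<in> B\<close> by (metis subsetI)
    then show ?thesis
      using stuck \<open>B = C\<close> \<open>card B = 3\<close> \<open>x \<in> B\<close> by blast
  qed
qed

lemma distinct_choice:
  assumes X: "card X \<ge> 3" and B: "card B \<ge> 3" and C: "card C \<ge> 3" and D: "card D \<ge> 2"
    and un: "card (X \<union> B \<union> C \<union> D) \<ge> 4"
  shows "\<exists>x\<in>X. \<exists>b\<in>B. \<exists>c\<in>C. \<exists>d\<in>D. distinct [x, b, c, d] \<and> \<not> (x = z \<and> b = y) \<and> (x, b, c) \<noteq> \<tau>"
proof -
  obtain \<tau>1 \<tau>2 where \<tau>: "\<tau> = (\<tau>1, \<tau>2)" by (cases \<tau>)
  show ?thesis
  proof (cases "B = C \<and> card B = 3 \<and> D \<subseteq> B")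
    case True
    show ?thesis
    \<comment> \<open>Now \<open>b\<close>, \<open>c\<close>, \<open>d\<close> use up
      \<open>B\<close>, so \<open>x\<close> must come from outside; otherwise the union would have
      only three colours.\<close>
    proof (cases "\<exists>x\<in>X. x \<notin> B")
      case True': True
      then obtain x where x: "x \<in> X" "x \<notin> B" by blast
      obtain b c d where "b \<in> B" "c \<in> B" "d \<in> D" "distinct [b, c, d]" "b \<noteq> y" "(b, c) \<noteq> \<tau>2"
        using three_set_choice[of B D y \<tau>2] True D by blast
      then have "distinct [x, b, c, d] \<and> \<not> (x = z \<and> b = y) \<and> (x, b, c) \<noteq> \<tau>"
        using x(2) True by (auto simp: \<tau>)
      then show ?thesis
        using x(1) True \<open>b \<in> B\<close> \<open>c \<in> B\<close> \<open>d \<in> D\<close> by blast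
    next
      case False
      then have "X \<union> B \<union> C \<union> D = B" using True by blast
      then show ?thesis using un True by auto
    qed
  next
    case False
    \<comment> \<open>Avoiding \<open>z\<close> and the first entry of \<open>\<tau>\<close> settles
      both side conditions through \<open>x\<close> alone.\<close>
    have "card (X - {z, \<tau>1}) > 0"
      using X card_Diff_subset[of "{z, \<tau>1}" X] diff_card_le_card_Diff[of "{z, \<tau>1}" X]
      by (auto simp: card_insert_if split: if_splits)
    then obtain x where x: "x \<in> X" "x \<noteq> z" "x \<noteq> \<tau>1"
      by (metis Diff_iff card_gt_0_iff equals0I insertCI)
    obtain b c d where "b \<in> B" "c \<in> C" "d \<in> D" "distinct [x, b, c, d]"
      using other_three_choice[of B C D x] False B C D by blast
    then show ?thesis
      using x \<tau> by (intro bexI[of _ x] bexI[of _ b] bexI[of _ c] bexI[of _ d]) auto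
  qed
qed


section \<open>Colouring a sequence of squares\<close>

text \<open>
  The colours of the \<open>s\<close>-th square are given by a function \<open>r\<close>, where \<open>r e f\<close> is the colour of the
  corner at position \<open>e\<close> in direction \<open>i\<close> and \<open>f\<close> in direction \<open>j\<close> (\<open>False\<close> is the smaller
  coordinate); \<open>out1\<close> and \<open>out2\<close> are the colours of the neighbours of the corner outside the square
  in these directions. The positions \<open>(k, t)\<close> of a plane with rows of length \<open>n\<close> are enumerated
  backwards, so that the successor of position \<open>s\<close> in direction \<open>k\<close> is \<open>s - n\<close> and that in
  direction \<open>t\<close> is \<open>s - 1\<close>, the latter unless \<open>n\<close> divides \<open>s\<close>.
\<close>

locale square_sequence =
  fixes n :: nat
    and lst :: "bool \<Rightarrow> bool \<Rightarrow> nat \<Rightarrow> 'c set"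
    and out1 out2 :: "bool \<Rightarrow> bool \<Rightarrow> nat \<Rightarrow> 'c option"
  assumes card_lst: "card (lst e f s) = 4"
    and out1_False: "out1 False f s = None"
    and out2_False: "out2 e False s = None"
begin

text \<open>Colours within a square will differ, so only neighbours outside it matter.
  \<open>k\<close> and \<open>t\<close> hold the colours of the successor squares in these
  directions, if any.\<close>

definition avail where
  "avail k t s e f = lst e f s - twice (out1 e f s) (out2 e f s)
    (map_option (\<lambda>r. r e f) k) (map_option (\<lambda>r. r e f) t)"

text \<open>
  Since three of the available sets have at least three elements and the fourth has at least two,
  the following condition is what Hall's theorem asks for.
\<close>

definition free where
  "free k t s \<longleftrightarrow> 4 \<le> card (avail k t s False False \<union> avail k t s True False
    \<union> avail k t s False True \<union> avail k t s True True)"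

text \<open>
  If \<open>r\<close> is used at the \<open>k\<close>-successor of \<open>s\<close>, then \<open>risky r s\<close> says that the single condition
  that the \<open>t\<close>-successor repeats the colour \<open>r False False\<close> may already leave only three colours
  for the square \<open>s\<close>. Without \<open>risky\<close>, two corners of the \<open>t\<close>-successor must have prescribed
  colours for this to happen.
\<close>

definition risky where
  "risky r s \<longleftrightarrow> out1 True False s = Some (r True False) \<and> out2 False True s = Some (r False True)
    \<and> r False False \<in> lst False False s
    \<and> lst False False s - {r False False} = lst True False s - {r True False}"

lemma finite_lst: "finite (lst e f s)"
  using card_lst[of e f s] by (simp add: card_ge_0_finite)

lemma finite_avail: "finite (avail k t s e f)"
  by (simp add: avail_def finite_lst)

text \<open>Every corner except the highest lacks a coloured neighbour in direction \<open>i\<close>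
  or \<open>j\<close>, so at most one colour is repeated around it.\<close>

lemma card_avail:
  "card (avail k t s e f) \<ge> 2" "\<not> (e \<and> f) \<Longrightarrow> card (avail k t s e f) \<ge> 3"
proof -
  let ?T = "twice (out1 e f s) (out2 e f s) (map_option (\<lambda>r. r e f) k) (map_option (\<lambda>r. r e f) t)"
  have *: "card (lst e f s) - card ?T \<le> card (avail k t s e f)"
    unfolding avail_def by (intro diff_card_le_card_Diff finite_twice)
  have "card ?T \<le> 2" by (rule card_twice)
  then show "card (avail k t s e f) \<ge> 2"
    using * card_lst[of e f s] by linarith
  assume "\<not> (e \<and> f)"
  then have "card ?T \<le> 1"
    using card_twice_None1 card_twice_None2 out1_False out2_False by (cases e) auto
  then show "card (avail k t s e f) \<ge> 3"
    using * card_lst[of e f s] by linarith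
qed

text \<open>The lowest corner then has at most one coloured neighbour, so its whole list remains
  available.\<close>

lemma free_None:
  assumes "k = None \<or> t = None"
  shows "free k t s"
proof -
  have "lst False False s \<subseteq> avail k t s False False"
    using assms by (auto simp: avail_def out1_False out2_False twice_def)
  then have "card (lst False False s) \<le> card (avail k t s False False \<union> avail k t s True False
    \<union> avail k t s False True \<union> avail k t s True True)"
    by (intro card_mono) (auto simp: finite_avail)
  then show ?thesis
    by (simp add: free_def card_lst)
qed

text \<open>With at most three available colours in all, the three corners having at least three
  must share the same set. So the lowest corner has lost a colour, which only the two successors
  together can take away.\<close>

lemma not_freeD:
  assumes "\<not> free (Some r') (Some r) s"
  shows "r False False = r' False False" "r' False False \<in> lst False False s"
    "avail (Some r') (Some r) s True False = lst False False s - {r' False False}"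
    "avail (Some r') (Some r) s False True = lst False False s - {r' False False}"
proof -
  let ?A = "avail (Some r') (Some r) s"
  let ?U = "?A False False \<union> ?A True False \<union> ?A False True \<union> ?A True True"
  have U: "card ?U \<le> 3" "finite ?U"
    using assms by (auto simp: free_def finite_avail)
  have eq: "?A e f = ?U" if "\<not> (e \<and> f)" for e f
  proof (rule card_seteq[OF U(2)])
    show "?A e f \<subseteq> ?U" using that by (cases e; cases f) auto
    show "card ?U \<le> card (?A e f)"
      using U(1) card_avail(2)[OF that, of "Some r'" "Some r" s] by linarith
  qed
  have "?A False False \<noteq> lst False False s"
    using eq[of False False] U(1) card_lst[of False False s] by auto
  then show *: "r False False = r' False False" "r' False False \<in> lst False False s"
    by (auto simp: avail_def twice_def out1_False out2_False)
  then have "?A False False = lst False False s - {r' False False}"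
    by (auto simp: avail_def twice_def out1_False out2_False)
  then show "?A True False = lst False False s - {r' False False}"
    "?A False True = lst False False s - {r' False False}"
    using eq[of False False] eq[of True False] eq[of False True] by auto
qed

lemma Diff_singleton_eqD:
  assumes "A - {x} = A - {y}" "x \<in> A"
  shows "x = y"
  using assms by blast

text \<open>A middle corner whose outer neighbour and \<open>k\<close>-successor differ in colour
  can lose only the colour of its \<open>t\<close>-successor, and being stuck prescribes which
  colour it loses. If the two colours agree at both middle corners, being stuck would make
  \<open>r'\<close> risky.\<close>

lemma pair_risky:
  assumes "\<not> risky r' s"
  shows "\<exists>z y. (\<forall>r. \<not> (r False False = z \<and> r True False = y) \<longrightarrow> free (Some r') (Some r) s) \<or>
    (\<forall>r. \<not> (r False False = z \<and> r False True = y) \<longrightarrow> free (Some r') (Some r) s)"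
proof -
  let ?M = "lst False False s - {r' False False}"
  have *: "\<exists>y. \<forall>r. avail (Some r') (Some r) s e f = ?M \<and> r' False False \<in> lst False False s \<longrightarrow> r e f = y"
    if out: "p \<noteq> Some (r' e f)"
      and p: "\<And>r. avail (Some r') (Some r) s e f = lst e f s - twice None p (Some (r' e f)) (Some (r e f))"
    for e f p
  proof -
    have M: "card ?M = 3" if "r' False False \<in> lst False False s"
      using that by (simp add: card_lst finite_lst)
    have "r e f \<in> lst e f s \<and> ?M = lst e f s - {r e f}"
      if "avail (Some r') (Some r) s e f = ?M" "r' False False \<in> lst False False s" for r
    proof -
      have "avail (Some r') (Some r) s e f \<noteq> lst e f s"
        using that(1) M[OF that(2)] card_lst[of e f s] by (metis numeral_eq_iff semiring_norm(88))
      then have "twice None p (Some (r' e f)) (Some (r e f)) \<inter> lst e f s \<noteq> {}"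
        unfolding p by blast
      moreover have "twice None p (Some (r' e f)) (Some (r e f)) \<subseteq> {r e f}"
        using out by (auto simp: twice_def)
      ultimately have "twice None p (Some (r' e f)) (Some (r e f)) = {r e f}" "r e f \<in> lst e f s"
        by blast+
      then show ?thesis
        using that unfolding p by simp
    qed
    then show ?thesis
      by (metis Diff_singleton_eqD)
  qed
  consider "out1 True False s \<noteq> Some (r' True False)" | "out2 False True s \<noteq> Some (r' False True)"
    | "out1 True False s = Some (r' True False)" "out2 False True s = Some (r' False True)"
    by blast
  then show ?thesis
  proof cases
    case 1
    have "avail (Some r') (Some r) s True False =
      lst True False s - twice None (out1 True False s) (Some (r' True False)) (Some (r True False))" for r
      by (auto simp: avail_def out2_False twice_def)
    from *[OF 1 this] show ?thesis
      using not_freeD by metis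
  next
    case 2
    have "avail (Some r') (Some r) s False True =
      lst False True s - twice None (out2 False True s) (Some (r' False True)) (Some (r False True))" for r
      by (auto simp: avail_def out1_False twice_def)
    from *[OF 2 this] show ?thesis
      using not_freeD by metis
  next
    case 3
    have "avail (Some r') (Some r) s True False = lst True False s - {r' True False}" for r
      using 3(1) by (auto simp: avail_def out2_False twice_def)
    then have "free (Some r') (Some r) s" for r
      using assms not_freeD[of r' r s] 3 by (auto simp: risky_def)
    then show ?thesis by blast
  qed
qed

text \<open>The outer colours determine two of the three colours, and the equality of the two
  reduced lists determines the third. So a single triple has to be avoided.\<close>

lemma risky_unique:
  "\<exists>\<tau>. \<forall>r. risky r s \<longrightarrow> (r False False, r True False, r False True) = \<tau>"
proof (cases "\<exists>r. risky r s")
  case True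
  then obtain r0 where "risky r0 s" by blast
  then have "(r False False, r True False, r False True) = (r0 False False, r0 True False, r0 False True)"
    if "risky r s" for r
    using that Diff_singleton_eqD[of "lst False False s" "r False False" "r0 False False"]
    unfolding risky_def by auto
  then show ?thesis by blast
qed auto

definition rainbow :: "(bool \<Rightarrow> bool \<Rightarrow> 'c) \<Rightarrow> bool" where
  "rainbow r \<longleftrightarrow> distinct [r False False, r True False, r False True, r True True]"

text \<open>Meant for \<open>s\<close> being the \<open>t\<close>-successor of \<open>s1\<close> and
  the \<open>k\<close>-successor of \<open>s2\<close>. Both demands of these later squares fit the
  side conditions of \<open>distinct_choice\<close>: one forbidden pair and one forbidden
  triple.\<close>

lemma next_square:
  assumes free: "free k t s" and pair: "k' \<noteq> None \<Longrightarrow> \<not> risky (the k') s1"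
  shows "\<exists>r. rainbow r \<and> (\<forall>e f. r e f \<in> avail k t s e f) \<and> \<not> risky r s2 \<and> free k' (Some r) s1"
proof -
  obtain \<tau> where \<tau>: "\<And>r. risky r s2 \<Longrightarrow> (r False False, r True False, r False True) = \<tau>"
    using risky_unique by blast
  obtain z y where zy: "(\<forall>r. \<not> (r False False = z \<and> r True False = y) \<longrightarrow> free k' (Some r) s1) \<or>
    (\<forall>r. \<not> (r False False = z \<and> r False True = y) \<longrightarrow> free k' (Some r) s1)"
    using pair_risky pair free_None by (cases k') (auto, blast)
  let ?A = "avail k t s"
  define mk where "mk x b c d e f = (if e then if f then d else b else if f then c else x)"
    for x b c d :: 'c and e f
  from zy show ?thesis
  proof
    assume zy: "\<forall>r. \<not> (r False False = z \<and> r True False = y) \<longrightarrow> free k' (Some r) s1"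
    obtain x b c d where *: "x \<in> ?A False False" "b \<in> ?A True False" "c \<in> ?A False True" "d \<in> ?A True True"
      "distinct [x, b, c, d]" "\<not> (x = z \<and> b = y)" "(x, b, c) \<noteq> \<tau>"
      using distinct_choice[of "?A False False" "?A True False" "?A False True" "?A True True" z y \<tau>]
        free card_avail by (auto simp: free_def)
    show ?thesis
      using * zy \<tau>[of "mk x b c d"]
      by (intro exI[of _ "mk x b c d"]) (auto simp: mk_def rainbow_def)
  next
    assume zy: "\<forall>r. \<not> (r False False = z \<and> r False True = y) \<longrightarrow> free k' (Some r) s1"
    \<comment> \<open>The forbidden pair now involves the other middle corner, so \<open>b\<close>
      and \<open>c\<close> change places, and with them the entries of
      \<open>\<tau>\<close>.\<close>
    define \<tau>' where "\<tau>' = (fst \<tau>, snd (snd \<tau>), fst (snd \<tau>))"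
    have "card (?A False False \<union> ?A False True \<union> ?A True False \<union> ?A True True) \<ge> 4"
      using free by (simp add: free_def Un_ac)
    from distinct_choice[OF card_avail(2) card_avail(2) card_avail(2) card_avail(1) this, of z y \<tau>']
    obtain x c b d where *: "x \<in> ?A False False" "b \<in> ?A True False" "c \<in> ?A False True" "d \<in> ?A True True"
      "distinct [x, c, b, d]" "\<not> (x = z \<and> c = y)" "(x, c, b) \<noteq> \<tau>'"
      by auto
    then have "\<not> risky (mk x b c d) s2"
      using \<tau>[of "mk x b c d"] by (auto simp: mk_def \<tau>'_def)
    with * zy show ?thesis
      by (intro exI[of _ "mk x b c d"]) (auto simp: mk_def rainbow_def)
  qed
qed

definition knext where
  "knext \<omega> s = (if n \<le> s then Some (\<omega> (s - n)) else None)"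

definition tnext where
  "tnext \<omega> s = (if s mod n \<noteq> 0 then Some (\<omega> (s - 1)) else None)"

theorem rainbow_sequence:
  assumes "n > 0"
  shows "\<exists>\<omega>. \<forall>s. rainbow (\<omega> s) \<and> (\<forall>e f. \<omega> s e f \<in> avail (knext \<omega> s) (tnext \<omega> s) s e f)"
proof -
  \<comment> \<open>The invariant looks ahead: \<open>s + n\<close> is the square with
    \<open>k\<close>-successor \<open>s\<close>, and \<open>Suc s\<close>, unless it starts a new
    row, the one with \<open>t\<close>-successor \<open>s\<close>.\<close>
  define P where "P \<omega> s r \<longleftrightarrow> rainbow r \<and> (\<forall>e f. r e f \<in> avail (knext \<omega> s) (tnext \<omega> s) s e f)
    \<and> \<not> risky r (s + n) \<and> (Suc s mod n \<noteq> 0 \<longrightarrow> free (knext \<omega> (Suc s)) (Some r) (Suc s))" for \<omega> s r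
  have "\<exists>\<omega>. \<forall>s. P \<omega> s (\<omega> s)"
  proof (rule dependent_wf_choice[of less_than])
    fix \<omega> \<omega>' :: "nat \<Rightarrow> bool \<Rightarrow> bool \<Rightarrow> 'c" and s :: nat and r :: "bool \<Rightarrow> bool \<Rightarrow> 'c"
    assume "\<And>z. (z, s) \<in> less_than \<Longrightarrow> \<omega> z = \<omega>' z"
    then have same: "\<omega> z = \<omega>' z" if "z < s" for z
      using that by simp
    \<comment> \<open>For \<open>n = 1\<close> the \<open>k\<close>-successor of
      \<open>Suc s\<close> would be \<open>s\<close> itself, whose colours are just being
      chosen.\<close>
    have n1: "n \<noteq> 1" if "Suc s mod n \<noteq> 0"
      using that by auto
    have "knext \<omega> s = knext \<omega>' s"
      using same assms by (auto simp: knext_def)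
    moreover have "tnext \<omega> s = tnext \<omega>' s"
      using same by (cases s) (auto simp: tnext_def)
    moreover have "knext \<omega> (Suc s) = knext \<omega>' (Suc s)" if "Suc s mod n \<noteq> 0"
      using same n1[OF that] assms by (auto simp: knext_def)
    ultimately show "P \<omega> s r = P \<omega>' s r"
      unfolding P_def by auto
  next
    fix s :: nat and \<omega> :: "nat \<Rightarrow> bool \<Rightarrow> bool \<Rightarrow> 'c"
    assume "\<And>z. (z, s) \<in> less_than \<Longrightarrow> P \<omega> z (\<omega> z)"
    then have IH: "P \<omega> z (\<omega> z)" if "z < s" for z
      using that by simp
    have free: "free (knext \<omega> s) (tnext \<omega> s) s"
    proof (cases "s mod n = 0")
      case True
      then show ?thesis by (intro free_None) (simp add: tnext_def)
    next
      case False
      then obtain s' where "s = Suc s'"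
        by (cases s) auto
      then show ?thesis
        using IH[of s'] False by (simp add: P_def tnext_def)
    qed
    show "\<exists>r. P \<omega> s r"
    proof (cases "Suc s mod n = 0")
      case True
      then show ?thesis
        using next_square[OF free, of None 0 "s + n"] by (auto simp: P_def)
    next
      case False
      then have "n \<noteq> 1" by auto
      have "\<not> risky (the (knext \<omega> (Suc s))) (Suc s)" if "knext \<omega> (Suc s) \<noteq> None"
        using that IH[of "Suc s - n"] \<open>n \<noteq> 1\<close> assms
        by (auto simp: knext_def P_def split: if_splits)
      then show ?thesis
        using next_square[OF free, of "knext \<omega> (Suc s)" "Suc s" "s + n"] by (auto simp: P_def)
    qed
  qed simp
  then show ?thesis
    unfolding P_def by blast
qed

end

section \<open>Extending a colouring by rainbow blocks\<close>

text \<open>Acyclicity of the classes is expressed by sparseness: every non-empty set of one colour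
  has a vertex with at most one neighbour in it. The bound \<open>(card W + 3) div 4\<close> is the
  ceiling of a quarter of \<open>card W\<close>.\<close>

definition good :: "('v \<Rightarrow> 'v \<Rightarrow> bool) \<Rightarrow> ('v \<Rightarrow> 'c set) \<Rightarrow> 'v set \<Rightarrow> ('v \<Rightarrow> 'c) \<Rightarrow> bool" where
  "good adj L W c \<longleftrightarrow> (\<forall>v\<in>W. c v \<in> L v)
    \<and> (\<forall>U\<subseteq>W. U \<noteq> {} \<and> (\<forall>u\<in>U. \<forall>v\<in>U. c u = c v) \<longrightarrow> (\<exists>v\<in>U. card {u \<in> U. adj v u} \<le> 1))
    \<and> (\<forall>y. card {v \<in> W. c v = y} \<le> (card W + 3) div 4)"

lemma goodI:
  assumes "\<And>v. v \<in> W \<Longrightarrow> c v \<in> L v"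
    and "\<And>U. U \<subseteq> W \<Longrightarrow> U \<noteq> {} \<Longrightarrow> (\<And>u v. u \<in> U \<Longrightarrow> v \<in> U \<Longrightarrow> c u = c v) \<Longrightarrow>
      \<exists>v\<in>U. card {u \<in> U. adj v u} \<le> 1"
    and "\<And>y. card {v \<in> W. c v = y} \<le> (card W + 3) div 4"
  shows "good adj L W c"
  unfolding good_def
proof (intro conjI ballI allI impI)
  fix U assume U: "U \<subseteq> W" "U \<noteq> {} \<and> (\<forall>u\<in>U. \<forall>v\<in>U. c u = c v)"
  show "\<exists>v\<in>U. card {u \<in> U. adj v u} \<le> 1"
    by (rule assms(2)[OF U(1)]) (use U(2) in blast)+
qed (rule assms(1,3); assumption?)+

lemma goodD:
  assumes "good adj L W c"
  shows good_list: "v \<in> W \<Longrightarrow> c v \<in> L v"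
    and good_sparse: "U \<subseteq> W \<Longrightarrow> U \<noteq> {} \<Longrightarrow> (\<And>u v. u \<in> U \<Longrightarrow> v \<in> U \<Longrightarrow> c u = c v) \<Longrightarrow>
      \<exists>v\<in>U. card {u \<in> U. adj v u} \<le> 1"
    and good_count: "card {v \<in> W. c v = y} \<le> (card W + 3) div 4"
proof -
  note * = assms[unfolded good_def]
  show "v \<in> W \<Longrightarrow> c v \<in> L v"
    using *[THEN conjunct1] by (rule bspec)
  show "card {v \<in> W. c v = y} \<le> (card W + 3) div 4"
    using *[THEN conjunct2, THEN conjunct2] by (rule spec)
  show "\<exists>v\<in>U. card {u \<in> U. adj v u} \<le> 1"
    if "U \<subseteq> W" "U \<noteq> {}" "\<And>u v. u \<in> U \<Longrightarrow> v \<in> U \<Longrightarrow> c u = c v"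
    using *[THEN conjunct2, THEN conjunct1] that by blast
qed

lemma good_empty: "good adj L {} c"
  by (rule goodI) auto

lemma good_cong:
  assumes good: "good adj L W c" and eq: "\<And>v. v \<in> W \<Longrightarrow> c v = c' v"
  shows "good adj L W c'"
proof (rule goodI)
  show "c' v \<in> L v" if "v \<in> W" for v
    using good_list[OF good that] eq[OF that] by simp
  show "\<exists>v\<in>U. card {u \<in> U. adj v u} \<le> 1"
    if "U \<subseteq> W" "U \<noteq> {}" "\<And>u v. u \<in> U \<Longrightarrow> v \<in> U \<Longrightarrow> c' u = c' v" for U
    using good_sparse[OF good that(1,2)] that eq by (metis subsetD)
  have "{v \<in> W. c' v = y} = {v \<in> W. c v = y}" for y
    using eq by auto
  then show "card {v \<in> W. c' v = y} \<le> (card W + 3) div 4" for y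
    using good_count[OF good] by simp
qed

text \<open>A monochromatic set that meets \<open>S\<close> does so in one vertex, which has at most
  one neighbour of its colour in \<open>W\<close>. Every class grows by at most one, and four new
  vertices raise the bound by one; a smaller block is allowed only at the start.\<close>

lemma good_block:
  assumes good: "good adj L W c" and fin: "finite W" "finite S" and disj: "W \<inter> S = {}"
    and size: "card S = 4 \<or> W = {} \<and> card S \<le> 4" and inj: "inj_on c S"
    and ok: "\<And>v. v \<in> S \<Longrightarrow> c v \<in> L v \<and> \<not> adj v v \<and> card {u \<in> W. adj v u \<and> c u = c v} \<le> 1"
  shows "good adj L (W \<union> S) c"
proof (rule goodI)
  show "c v \<in> L v" if "v \<in> W \<union> S" for v
    using that good_list[OF good] ok by auto
next
  fix U assume U: "U \<subseteq> W \<union> S" "U \<noteq> {}" "\<And>u v. u \<in> U \<Longrightarrow> v \<in> U \<Longrightarrow> c u = c v"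
  show "\<exists>v\<in>U. card {u \<in> U. adj v u} \<le> 1"
  proof (cases "U \<subseteq> W")
    case True
    then show ?thesis using good_sparse[OF good] U by blast
  next
    case False
    then obtain v where v: "v \<in> U" "v \<in> S" using U by blast
    have "u = v" if "u \<in> U" "u \<in> S" for u
      using inj_onD[OF inj U(3)[OF that(1) v(1)] that(2) v(2)] .
    then have "{u \<in> U. adj v u} \<subseteq> {u \<in> W. adj v u \<and> c u = c v}"
      using U(1) U(3)[OF _ v(1)] ok[OF v(2)] by blast
    then have "card {u \<in> U. adj v u} \<le> card {u \<in> W. adj v u \<and> c u = c v}"
      using fin by (intro card_mono) auto
    then show ?thesis
      using v ok[OF v(2)] by (meson le_trans)
  qed
next
  fix y
  have split: "{v \<in> W \<union> S. c v = y} = {v \<in> W. c v = y} \<union> {v \<in> S. c v = y}" by auto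
  have W: "card {v \<in> W. c v = y} \<le> (card W + 3) div 4"
    by (rule good_count[OF good])
  have S: "card {v \<in> S. c v = y} \<le> 1"
    using fin inj by (auto simp: card_le_Suc0_iff_eq dest: inj_onD)
  have Un: "card {v \<in> W \<union> S. c v = y} \<le> card {v \<in> W. c v = y} + card {v \<in> S. c v = y}"
    unfolding split by (rule card_Un_le)
  have card: "card (W \<union> S) = card W + card S"
    using fin disj by (simp add: card_Un_disjoint)
  show "card {v \<in> W \<union> S. c v = y} \<le> (card (W \<union> S) + 3) div 4"
  proof (cases "S = {}")
    case True
    then show ?thesis using W by simp
  next
    case False
    then have "card S > 0" using fin by (simp add: card_gt_0_iff)
    then show ?thesis
      using size W S Un card by auto
  qed
qed

lemma good_blocks:
  fixes S :: "nat \<Rightarrow> 'v set"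
  assumes "good adj L W c" "finite W"
    and "\<And>s. s < N \<Longrightarrow> card (S s) = 4 \<and> inj_on c (S s) \<and> W \<inter> S s = {} \<and> (\<forall>s'<s. S s' \<inter> S s = {})"
    and "\<And>s v. s < N \<Longrightarrow> v \<in> S s \<Longrightarrow> c v \<in> L v \<and> \<not> adj v v \<and>
      card {u \<in> W \<union> (\<Union>s'<s. S s'). adj v u \<and> c u = c v} \<le> 1"
  shows "good adj L (W \<union> (\<Union>s<N. S s)) c"
  using assms(3,4)
proof (induction N)
  case 0
  then show ?case using assms(1) by simp
next
  case (Suc N)
  have fin: "finite (S s)" if "s < Suc N" for s
    using Suc.prems(1)[OF that] by (simp add: card_ge_0_finite)
  have "good adj L (W \<union> (\<Union>s<N. S s) \<union> S N) c"
  proof (rule good_block)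
    show "good adj L (W \<union> (\<Union>s<N. S s)) c"
      using Suc.prems by (intro Suc.IH) (meson less_SucI)+
    show "(W \<union> (\<Union>s<N. S s)) \<inter> S N = {}"
      using Suc.prems(1)[of N] by auto
    show "finite (W \<union> (\<Union>s<N. S s))" "finite (S N)"
      using fin assms(2) by auto
    show "card (S N) = 4 \<or> W \<union> (\<Union>s<N. S s) = {} \<and> card (S N) \<le> 4" "inj_on c (S N)"
      using Suc.prems(1)[of N] by blast+
    show "c v \<in> L v \<and> \<not> adj v v \<and>
      card {u \<in> W \<union> (\<Union>s'<N. S s'). adj v u \<and> c u = c v} \<le> 1" if "v \<in> S N" for v
      using Suc.prems(2)[OF lessI that] .
  qed
  then show ?case
    by (simp add: lessThan_Suc Un_ac)
qed

text \<open>Two vertices of colour \<open>y\<close> in \<open>A\<close> would be different entries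
  among \<open>p\<close>, \<open>q\<close>, \<open>r\<close>, \<open>s\<close> and so make
  \<open>y\<close> a repeated colour.\<close>

lemma card_not_twice:
  assumes "\<And>u. u \<in> A \<Longrightarrow> Some u \<in> {p, q, r, s}"
    and "y \<notin> twice (map_option g p) (map_option g q) (map_option g r) (map_option g s)"
  shows "card {u \<in> A. g u = y} \<le> 1"
proof (rule ccontr)
  assume *: "\<not> ?thesis"
  then have "finite {u \<in> A. g u = y}"
    by (metis card.infinite zero_le)
  with * obtain u v where "u \<in> A" "v \<in> A" "g u = y" "g v = y" "u \<noteq> v"
    by (auto simp: card_le_Suc0_iff_eq)
  then show False
    using assms(1)[of u] assms(1)[of v] assms(2) by (auto simp: twice_def)
qed

section \<open>Coordinates of the grid and the blocks above a square of cells\<close>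

fun grid_adj :: "((nat \<times> nat) \<times> nat) \<times> nat \<Rightarrow> ((nat \<times> nat) \<times> nat) \<times> nat \<Rightarrow> bool" where
  "grid_adj (((i, j), k), t) (((i', j'), k'), t') \<longleftrightarrow>
    (i = i' \<and> j = j' \<and> k = k' \<and> (t = Suc t' \<or> t' = Suc t)) \<or>
    (i = i' \<and> j = j' \<and> t = t' \<and> (k = Suc k' \<or> k' = Suc k)) \<or>
    (i = i' \<and> k = k' \<and> t = t' \<and> (j = Suc j' \<or> j' = Suc j)) \<or>
    (j = j' \<and> k = k' \<and> t = t' \<and> (i = Suc i' \<or> i' = Suc i))"

definition square :: "nat \<Rightarrow> nat \<Rightarrow> (nat \<times> nat) set" where
  "square u w = {(i, j). i div 2 = u \<and> j div 2 = w}"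

definition region :: "(nat \<times> nat) set \<Rightarrow> nat \<Rightarrow> nat \<Rightarrow> (((nat \<times> nat) \<times> nat) \<times> nat) set" where
  "region C m n = (C \<times> {..<m}) \<times> {..<n}"

text \<open>\<open>pk\<close> and \<open>pt\<close> enumerate the plane backwards by rows, so the
  earlier of two neighbouring positions has the larger coordinate. A step in \<open>k\<close> shifts
  the index by \<open>n\<close>; a step in \<open>t\<close> stays in the row and shifts it by
  one.\<close>

lemma reversed_index_step:
  fixes m n s s' :: nat
  defines "pk x \<equiv> m - 1 - x div n" and "pt x \<equiv> n - 1 - x mod n"
  assumes s: "s < m * n" "s' < s"
    and step: "pk s = pk s' \<and> (pt s = Suc (pt s') \<or> pt s' = Suc (pt s)) \<or>
      pt s = pt s' \<and> (pk s = Suc (pk s') \<or> pk s' = Suc (pk s))"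
  shows "s = s' + n \<or> s mod n \<noteq> 0 \<and> s = Suc s'"
proof -
  have n: "n > 0" using s by (cases n) auto
  obtain q r where qr: "s div n = q" "s mod n = r" by blast
  obtain q' r' where qr': "s' div n = q'" "s' mod n = r'" by blast
  have eq: "s = q * n + r" "s' = q' * n + r'" "r < n" "r' < n"
    using n qr qr' by auto
  have le: "q < m" "q' \<le> q"
    using s less_mult_imp_div_less[of s m n] div_le_mono[of s' s n] qr qr' by auto
  have pk: "pk s = m - 1 - q" "pk s' = m - 1 - q'" and pt: "pt s = n - 1 - r" "pt s' = n - 1 - r'"
    by (simp_all add: pk_def pt_def qr qr')
  have "q = q'" if "pk s = pk s'"
    using that le unfolding pk by linarith
  moreover have "q = Suc q'" if "pk s' = Suc (pk s)"
    using that le unfolding pk by linarith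
  moreover have "pk s \<noteq> Suc (pk s')"
    using le unfolding pk by linarith
  moreover have "r = r'" if "pt s = pt s'"
    using that eq(3,4) unfolding pt by linarith
  moreover have "r' = Suc r" if "pt s = Suc (pt s')"
    using that eq(3,4) unfolding pt by linarith
  moreover have "r = Suc r'" if "pt s' = Suc (pt s)"
    using that eq(3,4) unfolding pt by linarith
  ultimately consider "q = q'" "r = Suc r' \<or> r' = Suc r" | "r = r'" "q = Suc q'"
    using step by blast
  then show ?thesis
  proof cases
    case 1
    then show ?thesis using eq s qr(2) by auto
  next
    case 2
    then show ?thesis using eq by simp
  qed
qed
text \<open>\<open>C\<close> avoids the square and the cells just before it in directions
  \<open>i\<close> and \<open>j\<close>, so coloured neighbours in these directions exist only
  beyond the far corners, as \<open>square_sequence\<close> demands of \<open>out1\<close> and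
  \<open>out2\<close>.\<close>

lemma square_extension:
  fixes L :: "((nat \<times> nat) \<times> nat) \<times> nat \<Rightarrow> 'c set"
  assumes good: "good grid_adj L (region C m n) c" and fin: "finite C"
    and L: "\<And>v. v \<in> region (square u w) m n \<Longrightarrow> card (L v) = 4"
    and C: "\<And>i j. (i, j) \<in> C \<Longrightarrow> \<not> (i div 2 = u \<and> j div 2 = w) \<and>
      \<not> (Suc i = 2 * u \<and> j div 2 = w) \<and> \<not> (i div 2 = u \<and> Suc j = 2 * w)"
  shows "\<exists>c'. good grid_adj L (region (C \<union> square u w) m n) c'"
proof (cases "m = 0 \<or> n = 0")
  case True
  then show ?thesis
    by (auto simp: region_def good_empty)
next
  case False
  then have mn: "m > 0" "n > 0" by auto
  define pk where "pk s = m - 1 - s div n" for s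
  define pt where "pt s = n - 1 - s mod n" for s
  \<comment> \<open>\<open>pos\<close> inverts the enumeration by \<open>pk\<close> and
    \<open>pt\<close>; \<open>v1\<close> to \<open>v4\<close> below are the possible coloured
    neighbours of a corner in directions \<open>i\<close>, \<open>j\<close>, \<open>k\<close>,
    \<open>t\<close>.\<close>
  define pos where "pos k t = (m - 1 - k) * n + (n - 1 - t)" for k t
  define vtx where "vtx e f s = (((2 * u + of_bool e, 2 * w + of_bool f), pk s), pt s)" for e f s
  define v1 where "v1 e f s = (if e \<and> (2 * u + 2, 2 * w + of_bool f) \<in> C
    then Some (((2 * u + 2, 2 * w + of_bool f), pk s), pt s) else None)" for e f s
  define v2 where "v2 e f s = (if f \<and> (2 * u + of_bool e, 2 * w + 2) \<in> C
    then Some (((2 * u + of_bool e, 2 * w + 2), pk s), pt s) else None)" for e f s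
  define v3 where "v3 e f s = (if n \<le> s then Some (vtx e f (s - n)) else None)" for e f s
  define v4 where "v4 e f s = (if s mod n \<noteq> 0 then Some (vtx e f (s - 1)) else None)" for e f s
  have range: "pk s < m" "pt s < n" for s
    using mn by (auto simp: pk_def pt_def)
  have div_less: "s div n < m" if "s < m * n" for s
    using that by (simp add: less_mult_imp_div_less)
  have pos_inv: "pos (pk s) (pt s) = s" if "s < m * n" for s
  proof -
    have "m - 1 - pk s = s div n" "n - 1 - pt s = s mod n"
      using div_less[OF that] mn mod_less_divisor[of n s] unfolding pk_def pt_def by linarith+
    then show ?thesis by (simp add: pos_def)
  qed
  have pk_pos: "pos k t < m * n" "pk (pos k t) = k" "pt (pos k t) = t" if "k < m" "t < n" for k t
  proof -
    have t: "n - 1 - t < n" using mn by linarith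
    then have dm: "pos k t div n = m - 1 - k" "pos k t mod n = n - 1 - t"
      by (simp_all add: pos_def)
    then show "pk (pos k t) = k" "pt (pos k t) = t"
      using that by (auto simp: pk_def pt_def)
    have "pos k t < (m - 1 - k) * n + n" using t by (simp add: pos_def)
    also have "\<dots> = (m - k) * n" using that by (cases "m - k") (simp_all add: Suc_diff_Suc)
    also have "\<dots> \<le> m * n" by simp
    finally show "pos k t < m * n" .
  qed
  have vtx_in: "vtx e f s \<in> region (square u w) m n" for e f s
    using range by (auto simp: vtx_def region_def square_def)
  interpret square_sequence n "\<lambda>e f s. L (vtx e f s)" "\<lambda>e f s. map_option c (v1 e f s)"
    "\<lambda>e f s. map_option c (v2 e f s)"
  proof
    show "card (L (vtx e f s)) = 4" for e f s
      by (rule L[OF vtx_in])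
    show "map_option c (v1 False f s) = None" "map_option c (v2 e False s) = None" for e f s
      by (simp_all add: v1_def v2_def)
  qed
  obtain \<omega> where \<omega>: "\<And>s. rainbow (\<omega> s)"
    "\<And>s e f. \<omega> s e f \<in> avail (knext \<omega> s) (tnext \<omega> s) s e f"
    using rainbow_sequence[OF mn(2)] by blast
  define c' where "c' = (\<lambda>(((i, j), k), t). if i div 2 = u \<and> j div 2 = w
    then \<omega> (pos k t) (odd i) (odd j) else c (((i, j), k), t))"
  define S where "S s = {vtx False False s, vtx True False s, vtx False True s, vtx True True s}" for s
  have S_mem: "vtx e f s \<in> S s" for e f s
    by (cases e; cases f) (simp_all add: S_def)
  have S_E: "\<exists>e f. v = vtx e f s" if "v \<in> S s" for v s
    using that by (auto simp: S_def)
  have c'_vtx: "c' (vtx e f s) = \<omega> s e f" if "s < m * n" for e f s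
    by (simp add: c'_def vtx_def pos_inv[OF that])
  have c'_C: "c' v = c v" if v_in: "v \<in> region C m n" for v
  proof -
    obtain i j k t where v: "v = (((i, j), k), t)" "(i, j) \<in> C"
      using v_in by (auto simp: region_def)
    show ?thesis
      using C[OF v(2)] by (auto simp: c'_def v(1))
  qed
  have vtx_eq: "vtx e f s = vtx e' f' s' \<longleftrightarrow> e = e' \<and> f = f' \<and> s = s'" if "s < m * n" "s' < m * n" for e f s e' f' s'
  proof
    assume *: "vtx e f s = vtx e' f' s'"
    then have "pk s = pk s'" "pt s = pt s'" by (auto simp: vtx_def)
    then have "s = s'" using pos_inv that by metis
    then show "e = e' \<and> f = f' \<and> s = s'" using * by (auto simp: vtx_def of_bool_def split: if_splits)
  qed simp
  have S_disjoint: "S s' \<inter> S s = {}" if "s < m * n" "s' < s" for s s'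
  proof (rule equals0I)
    fix x assume "x \<in> S s' \<inter> S s"
    then obtain e f e' f' where "vtx e f s = vtx e' f' s'"
      using S_E by (metis IntE)
    then show False
      using that by (simp add: vtx_eq)
  qed
  have vtx_notin: "vtx e f s \<notin> region C m n" for e f s
    using C[of "2 * u + of_bool e" "2 * w + of_bool f"] by (cases e; cases f) (auto simp: vtx_def region_def)
  \<comment> \<open>This guarantees that \<open>avail\<close> has accounted for every neighbour
    coloured before the block \<open>s\<close>.\<close>
  have nbr: "Some x \<in> {v1 e f s, v2 e f s, v3 e f s, v4 e f s}"
    if s: "s < m * n" and x: "x \<in> region C m n \<union> (\<Union>s'<s. S s')" and adj: "grid_adj (vtx e f s) x" for x e f s
    using x
  proof
    assume "x \<in> region C m n"
    then obtain i j k t where x: "x = (((i, j), k), t)" "(i, j) \<in> C"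
      by (auto simp: region_def)
    define ci cj where "ci = 2 * u + of_bool e" "cj = 2 * w + of_bool f"
    have div: "ci div 2 = u" "cj div 2 = w"
      by (simp_all add: ci_cj_def)
    have "\<not> (i = ci \<and> j = cj)"
      using C[OF x(2)] div by blast
    moreover have "grid_adj (((ci, cj), pk s), pt s) (((i, j), k), t)"
      using adj by (simp add: x(1) vtx_def ci_cj_def)
    ultimately consider "j = cj" "k = pk s" "t = pt s" "ci = Suc i \<or> i = Suc ci"
      | "i = ci" "k = pk s" "t = pt s" "cj = Suc j \<or> j = Suc cj"
      by (simp only: grid_adj.simps) metis
    then have "i = 2 * u + 2 \<and> e \<and> j = 2 * w + of_bool f \<and> k = pk s \<and> t = pt s \<or>
      j = 2 * w + 2 \<and> f \<and> i = 2 * u + of_bool e \<and> k = pk s \<and> t = pt s"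
    proof cases
      case 1
      then have "i div 2 \<noteq> u" "Suc i \<noteq> 2 * u"
        using C[OF x(2)] div(2) by blast+
      then show ?thesis
        using 1 by (cases e) (auto simp: ci_cj_def)
    next
      case 2
      then have "j div 2 \<noteq> w" "Suc j \<noteq> 2 * w"
        using C[OF x(2)] div(1) by blast+
      then show ?thesis
        using 2 by (cases f) (auto simp: ci_cj_def)
    qed
    then show ?thesis
      using x(2) unfolding x(1) v1_def v2_def by (elim disjE conjE) simp_all
  next
    assume "x \<in> (\<Union>s'<s. S s')"
    then obtain s' e' f' where s': "s' < s" "x = vtx e' f' s'"
      using S_E by blast
    have ne: "\<not> (pk s = pk s' \<and> pt s = pt s')"
      using pos_inv[OF s] pos_inv[of s'] s' s by (metis less_trans nat_neq_iff)
    have "e = e' \<and> f = f' \<and> (pk s = pk s' \<and> (pt s = Suc (pt s') \<or> pt s' = Suc (pt s)) \<or>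
      pt s = pt s' \<and> (pk s = Suc (pk s') \<or> pk s' = Suc (pk s)))"
      using adj ne by (auto simp: s'(2) vtx_def of_bool_def split: if_splits)
    then have ef: "e = e'" "f = f'" and "s = s' + n \<or> s mod n \<noteq> 0 \<and> s = Suc s'"
      using reversed_index_step[OF s s'(1)] unfolding pk_def pt_def by blast+
    then show ?thesis
      by (auto simp: v3_def v4_def s'(2))
  qed
  have "good grid_adj L (region C m n \<union> (\<Union>s<m * n. S s)) c'"
  proof (rule good_blocks)
    show "good grid_adj L (region C m n) c'"
      using good by (rule good_cong) (simp add: c'_C)
    show "finite (region C m n)"
      using fin by (simp add: region_def)
    fix s assume s: "s < m * n"
    show "card (S s) = 4 \<and> inj_on c' (S s) \<and> region C m n \<inter> S s = {} \<and> (\<forall>s'<s. S s' \<inter> S s = {})"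
    proof (intro conjI)
      show "card (S s) = 4"
        using s by (simp add: S_def vtx_eq)
      show "inj_on c' (S s)"
        using \<omega>(1)[of s] s by (auto simp: S_def inj_on_def c'_vtx rainbow_def)
      show "region C m n \<inter> S s = {}"
        using vtx_notin S_E by blast
      show "\<forall>s'<s. S s' \<inter> S s = {}"
        using S_disjoint s by blast
    qed
    fix v assume "v \<in> S s"
    then obtain e f where v: "v = vtx e f s" using S_E by blast
    have av: "c' v \<in> avail (knext \<omega> s) (tnext \<omega> s) s e f"
      using \<omega>(2) s by (simp add: v c'_vtx)
    have m1: "map_option c (v1 e f s) = map_option c' (v1 e f s)"
      using range by (auto simp: v1_def region_def intro!: c'_C[symmetric])
    have m2: "map_option c (v2 e f s) = map_option c' (v2 e f s)"
      using range by (auto simp: v2_def region_def intro!: c'_C[symmetric])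
    have m3: "map_option (\<lambda>r. r e f) (knext \<omega> s) = map_option c' (v3 e f s)"
      using s by (auto simp: knext_def v3_def c'_vtx)
    have m4: "map_option (\<lambda>r. r e f) (tnext \<omega> s) = map_option c' (v4 e f s)"
      using s by (auto simp: tnext_def v4_def c'_vtx)
    show "c' v \<in> L v \<and> \<not> grid_adj v v \<and>
      card {x \<in> region C m n \<union> (\<Union>s'<s. S s'). grid_adj v x \<and> c' x = c' v} \<le> 1"
    proof (intro conjI)
      show "c' v \<in> L v" using av by (simp add: avail_def v)
      show "\<not> grid_adj v v" by (simp add: v vtx_def)
      have "c' v \<notin> twice (map_option c' (v1 e f s)) (map_option c' (v2 e f s))
        (map_option c' (v3 e f s)) (map_option c' (v4 e f s))"
        using av by (simp add: avail_def m1 m2 m3 m4)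
      from card_not_twice[OF _ this, of "{x \<in> region C m n \<union> (\<Union>s'<s. S s'). grid_adj v x}"] nbr[OF s]
      show "card {x \<in> region C m n \<union> (\<Union>s'<s. S s'). grid_adj v x \<and> c' x = c' v} \<le> 1"
        by (simp add: v)
    qed
  qed
  moreover have "region (square u w) m n = (\<Union>s<m * n. S s)"
  proof
    show "region (square u w) m n \<subseteq> (\<Union>s<m * n. S s)"
    proof
      fix x assume "x \<in> region (square u w) m n"
      then obtain i j k t where x: "x = (((i, j), k), t)" "i div 2 = u" "j div 2 = w" "k < m" "t < n"
        by (auto simp: region_def square_def)
      then have "i = 2 * u + of_bool (odd i)" "j = 2 * w + of_bool (odd j)"
        by auto
      with x have "x = vtx (odd i) (odd j) (pos k t)" "pos k t < m * n"
        by (simp_all add: vtx_def pk_pos)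
      then show "x \<in> (\<Union>s<m * n. S s)"
        using S_mem by blast
    qed
    show "(\<Union>s<m * n. S s) \<subseteq> region (square u w) m n"
      using vtx_in S_E by blast
  qed
  ultimately have "good grid_adj L (region C m n \<union> region (square u w) m n) c'"
    by simp
  moreover have "region C m n \<union> region (square u w) m n = region (C \<union> square u w) m n"
    by (auto simp: region_def)
  ultimately show ?thesis
    by auto
qed

section \<open>Grids\<close>

definition choosable :: "'c itself \<Rightarrow> ('v \<Rightarrow> 'v \<Rightarrow> bool) \<Rightarrow> 'v set \<Rightarrow> bool" where
  "choosable (_ :: 'c itself) adj V \<longleftrightarrow>
    (\<forall>L :: 'v \<Rightarrow> 'c set. (\<forall>v\<in>V. card (L v) = 4) \<longrightarrow> (\<exists>c. good adj L V c))"

text \<open>The lists are moved along the inverse of \<open>f\<close> and the colouring is composed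
  with \<open>f\<close>. Further edges in the image are harmless, as they only make sparseness there
  stronger.\<close>

lemma choosable_transfer:
  assumes ch: "choosable TYPE('c) adj V" and bij: "bij_betw f V' V"
    and adj: "\<And>u v. u \<in> V' \<Longrightarrow> v \<in> V' \<Longrightarrow> adj' u v \<Longrightarrow> adj (f u) (f v)" and fin: "finite V'"
  shows "choosable TYPE('c) adj' V'"
  unfolding choosable_def
proof (intro allI impI)
  fix L :: "'b \<Rightarrow> 'c set" assume L: "\<forall>v\<in>V'. card (L v) = 4"
  have inj: "inj_on f V'" and img: "f ` V' = V"
    using bij by (auto simp: bij_betw_def)
  have "\<forall>v\<in>V. card (L (inv_into V' f v)) = 4"
    using L img by (auto simp: inv_into_into)
  then obtain c where c: "good adj (\<lambda>v. L (inv_into V' f v)) V c"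
    using ch[unfolded choosable_def, THEN spec, of "\<lambda>v. L (inv_into V' f v)"] by blast
  have "good adj' L V' (c \<circ> f)"
  proof (rule goodI)
    fix v assume "v \<in> V'"
    then show "(c \<circ> f) v \<in> L v"
      using good_list[OF c, of "f v"] img inj by auto
  next
    fix U assume U: "U \<subseteq> V'" "U \<noteq> {}" "\<And>u v. u \<in> U \<Longrightarrow> v \<in> U \<Longrightarrow> (c \<circ> f) u = (c \<circ> f) v"
    have "f ` U \<subseteq> V" "f ` U \<noteq> {}"
      using U(1,2) img by auto
    moreover have "c u = c v" if "u \<in> f ` U" "v \<in> f ` U" for u v
      using that U(3) by (metis comp_apply imageE)
    ultimately obtain v where v: "v \<in> U" "card {u \<in> f ` U. adj (f v) u} \<le> 1"
      using good_sparse[OF c, of "f ` U"] by blast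
    have "card {u \<in> U. adj' v u} = card (f ` {u \<in> U. adj' v u})"
      using inj U(1) by (intro card_image[symmetric] inj_on_subset[OF inj]) auto
    also have "\<dots> \<le> card {u \<in> f ` U. adj (f v) u}"
      using fin U(1) v(1) adj by (intro card_mono) (auto dest: finite_subset)
    finally show "\<exists>v\<in>U. card {u \<in> U. adj' v u} \<le> 1"
      using v by (meson le_trans)
  next
    fix y
    have "card {v \<in> V'. (c \<circ> f) v = y} = card (f ` {v \<in> V'. (c \<circ> f) v = y})"
      by (intro card_image[symmetric] inj_on_subset[OF inj]) auto
    also have "f ` {v \<in> V'. (c \<circ> f) v = y} = {v \<in> V. c v = y}"
      using img by auto
    also have "card \<dots> \<le> (card V + 3) div 4"
      by (rule good_count[OF c])
    also have "card V = card V'"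
      using bij by (simp add: bij_betw_same_card)
    finally show "card {v \<in> V'. (c \<circ> f) v = y} \<le> (card V' + 3) div 4" .
  qed
  then show "\<exists>c. good adj' L V' c" by blast
qed

text \<open>For \<open>i < n1\<close>, the equation \<open>i div 2 = n1 div 2\<close> singles out
  the last index of an odd \<open>n1\<close>, which belongs to no full pair.\<close>

definition tail_cells :: "nat \<Rightarrow> nat \<Rightarrow> (nat \<times> nat) set" where
  "tail_cells n1 n2 = {(i, j). i < n1 \<and> j < n2 \<and> (i div 2 = n1 div 2 \<or> j div 2 = n2 div 2)}"

lemma squares_extension:
  fixes L :: "((nat \<times> nat) \<times> nat) \<times> nat \<Rightarrow> 'c set"
  assumes "good grid_adj L (region (tail_cells n1 n2) m n) c0"
    and L: "\<And>v. v \<in> region ({..<n1} \<times> {..<n2}) m n \<Longrightarrow> card (L v) = 4"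
    and "Z \<subseteq> {..<n1 div 2} \<times> {..<n2 div 2}"
  shows "\<exists>c. good grid_adj L (region (tail_cells n1 n2 \<union> (\<Union>(u, w)\<in>Z. square u w)) m n) c"
proof -
  have "finite Z"
    using assms(3) by (rule finite_subset) simp
  then show ?thesis
    using assms(3)
  proof (induction "card Z" arbitrary: Z)
    case 0
    then show ?case using assms(1) by auto
  next
    case (Suc d)
    then have "Z \<noteq> {}" by auto
    \<comment> \<open>The square coloured last has the least \<open>u + w\<close>, so the squares
      just before it in either direction are not among those coloured earlier.\<close>
    define z where "z = arg_min_on (\<lambda>(u, w). u + w) Z"
    have z: "z \<in> Z" and min: "\<And>z'. z' \<in> Z \<Longrightarrow> (\<lambda>(u, w). u + w) z \<le> (\<lambda>(u, w). u + w) z'"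
      using arg_min_if_finite[OF Suc.prems(1) \<open>Z \<noteq> {}\<close>, of "\<lambda>(u, w). u + w"]
      by (auto simp: z_def not_less)
    obtain u w where uw: "z = (u, w)" by fastforce
    let ?C = "tail_cells n1 n2 \<union> (\<Union>(u, w)\<in>Z - {z}. square u w)"
    have lt: "u < n1 div 2" "w < n2 div 2"
      using z Suc.prems(2) uw by auto
    have below: "(u - 1, w) \<notin> Z" if "u > 0"
      using min[of "(u - 1, w)"] that by (auto simp: uw)
    have left: "(u, w - 1) \<notin> Z" if "w > 0"
      using min[of "(u, w - 1)"] that by (auto simp: uw)
    have C: "i < n1 \<and> j < n2 \<and> (i div 2 = n1 div 2 \<or> j div 2 = n2 div 2 \<or> (i div 2, j div 2) \<in> Z - {z})"
      if "(i, j) \<in> ?C" for i j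
      using that Suc.prems(2) by (auto simp: tail_cells_def square_def)
    have "card (Z - {z}) = d"
      using Suc z by simp
    then obtain c where "good grid_adj L (region ?C m n) c"
      using Suc.hyps(1)[of "Z - {z}"] Suc.prems by blast
    moreover have "finite ?C"
      by (rule finite_subset[of _ "{..<n1} \<times> {..<n2}"]) (use C in auto)
    moreover have "card (L v) = 4" if "v \<in> region (square u w) m n" for v
      using that lt by (intro L) (auto simp: region_def square_def)
    moreover have "\<not> (i div 2 = u \<and> j div 2 = w) \<and> \<not> (Suc i = 2 * u \<and> j div 2 = w) \<and>
      \<not> (i div 2 = u \<and> Suc j = 2 * w)" if "(i, j) \<in> ?C" for i j
    proof (intro conjI notI; elim conjE)
      assume "i div 2 = u" "j div 2 = w"
      then show False using C[OF that] lt uw by auto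
    next
      assume *: "Suc i = 2 * u" "j div 2 = w"
      then have "u > 0" "i div 2 = u - 1" by auto
      then show False using C[OF that] lt below * by auto
    next
      assume *: "i div 2 = u" "Suc j = 2 * w"
      then have "w > 0" "j div 2 = w - 1" by auto
      then show False using C[OF that] lt left * by auto
    qed
    ultimately obtain c' where "good grid_adj L (region (?C \<union> square u w) m n) c'"
      using square_extension[of L ?C m n c u w] by blast
    moreover have "?C \<union> square u w = tail_cells n1 n2 \<union> (\<Union>(u, w)\<in>Z. square u w)"
      using z uw by auto
    ultimately show ?case by auto
  qed
qed

lemma region_choosable:
  assumes "choosable TYPE('c) grid_adj (region (tail_cells n1 n2) m n)"
  shows "choosable TYPE('c) grid_adj (region ({..<n1} \<times> {..<n2}) m n)"
  unfolding choosable_def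
proof (intro allI impI)
  fix L :: "((nat \<times> nat) \<times> nat) \<times> nat \<Rightarrow> 'c set"
  assume L: "\<forall>v\<in>region ({..<n1} \<times> {..<n2}) m n. card (L v) = 4"
  have "region (tail_cells n1 n2) m n \<subseteq> region ({..<n1} \<times> {..<n2}) m n"
    by (auto simp: region_def tail_cells_def)
  then obtain c where "good grid_adj L (region (tail_cells n1 n2) m n) c"
    using assms L unfolding choosable_def by blast
  then obtain c' where c': "good grid_adj L (region (tail_cells n1 n2 \<union>
    (\<Union>(u, w)\<in>{..<n1 div 2} \<times> {..<n2 div 2}. square u w)) m n) c'"
    using squares_extension[of L n1 n2 m n c "{..<n1 div 2} \<times> {..<n2 div 2}"] L by blast
  have half: "i div 2 < n div 2 \<or> i div 2 = n div 2" if "i < n" for i n :: nat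
    using that by linarith
  have "tail_cells n1 n2 \<union> (\<Union>(u, w)\<in>{..<n1 div 2} \<times> {..<n2 div 2}. square u w) = {..<n1} \<times> {..<n2}"
    using half by (auto simp: tail_cells_def square_def)
  then show "\<exists>c. good grid_adj L (region ({..<n1} \<times> {..<n2}) m n) c"
    using c' by auto
qed

text \<open>
  The cells outside the squares form a path (an L-shaped one if \<open>n1\<close> and \<open>n2\<close> are odd), so the
  part of the grid above them is again a grid, with one dimension less.
\<close>

lemma tail_cells_path:
  "\<exists>a f. bij_betw f (tail_cells n1 n2) {..<a} \<and>
    (\<forall>i j j'. (i, j) \<in> tail_cells n1 n2 \<and> (i, j') \<in> tail_cells n1 n2 \<and> j' = Suc j \<longrightarrow>
      f (i, j) = Suc (f (i, j')) \<or> f (i, j') = Suc (f (i, j))) \<and>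
    (\<forall>i i' j. (i, j) \<in> tail_cells n1 n2 \<and> (i', j) \<in> tail_cells n1 n2 \<and> i' = Suc i \<longrightarrow>
      f (i, j) = Suc (f (i', j)) \<or> f (i', j) = Suc (f (i, j)))"
proof -
  have half: "i div 2 = n div 2 \<longleftrightarrow> odd n \<and> i = n - 1" if "i < n" for i n :: nat
    using that by (cases "even n") (auto elim!: evenE oddE)
  have T: "tail_cells n1 n2 = {(i, j). i < n1 \<and> j < n2 \<and> (odd n1 \<and> i = n1 - 1 \<or> odd n2 \<and> j = n2 - 1)}"
    using half by (auto simp: tail_cells_def)
  consider "even n1" "even n2" | "odd n1" "even n2" | "even n1" "odd n2" | "odd n1" "odd n2"
    by blast
  then show ?thesis
  proof cases
    case 1
    then show ?thesis
      by (intro exI[of _ 0] exI[of _ "\<lambda>_. 0"]) (auto simp: T bij_betw_def)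
  next
    case 2
    have "bij_betw snd (tail_cells n1 n2) {..<n2}"
      using 2 by (intro bij_betw_byWitness[where f' = "\<lambda>j. (n1 - 1, j)"]) (auto simp: T odd_pos)
    then show ?thesis
      using 2 by (intro exI[of _ n2] exI[of _ snd]) (auto simp: T)
  next
    case 3
    have "bij_betw fst (tail_cells n1 n2) {..<n1}"
      using 3 by (intro bij_betw_byWitness[where f' = "\<lambda>i. (i, n2 - 1)"]) (auto simp: T odd_pos)
    then show ?thesis
      using 3 by (intro exI[of _ n1] exI[of _ fst]) (auto simp: T)
  next
    case 4
    then have pos: "n1 > 0" "n2 > 0" by (auto simp: odd_pos)
    \<comment> \<open>The path follows the last row up to the corner cell, whose value is
      \<open>n2 - 1\<close>, and then goes back along the last column.\<close>
    define f where "f = (\<lambda>(i, j). j + (n1 - 1 - i))"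
    have "bij_betw f (tail_cells n1 n2) {..<n1 + n2 - 1}"
      using 4 pos by (intro bij_betw_byWitness[where f' = "\<lambda>x. if x < n2 then (n1 - 1, x) else (n1 + n2 - 2 - x, n2 - 1)"])
        (auto simp: T f_def)
    moreover have "f (i, j') = Suc (f (i, j))" if "(i, j) \<in> tail_cells n1 n2" "j' = Suc j" for i j j'
      using that by (simp add: f_def)
    moreover have "f (i, j) = Suc (f (i', j))" if "(i', j) \<in> tail_cells n1 n2" "i' = Suc i" for i i' j
      using that by (auto simp: f_def T)
    ultimately show ?thesis
      by (intro exI[of _ "n1 + n2 - 1"] exI[of _ f]) blast
  qed
qed

section \<open>Reduction of boxes to a path\<close>

abbreviation box_choosable :: "'c itself \<Rightarrow> nat \<Rightarrow> nat \<Rightarrow> nat \<Rightarrow> nat \<Rightarrow> bool" where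
  "box_choosable T n1 n2 n3 n4 \<equiv> choosable T grid_adj (region ({..<n1} \<times> {..<n2}) n3 n4)"

text \<open>\<open>a\<close> is the number of leftover cells, laid out along their path. It is
  independent of \<open>m\<close> and \<open>n\<close>, so it can be fixed before these are
  chosen.\<close>

lemma box_choosable_reduce:
  "\<exists>a. \<forall>m n. box_choosable TYPE('c) a 1 m n \<longrightarrow> box_choosable TYPE('c) n1 n2 m n"
proof -
  let ?T = "tail_cells n1 n2"
  obtain a f where bij: "bij_betw f ?T {..<a}"
    and f1: "\<And>i j. (i, j) \<in> ?T \<Longrightarrow> (i, Suc j) \<in> ?T \<Longrightarrow> f (i, j) = Suc (f (i, Suc j)) \<or> f (i, Suc j) = Suc (f (i, j))"
    and f2: "\<And>i j. (i, j) \<in> ?T \<Longrightarrow> (Suc i, j) \<in> ?T \<Longrightarrow> f (i, j) = Suc (f (Suc i, j)) \<or> f (Suc i, j) = Suc (f (i, j))"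
    using tail_cells_path[of n1 n2] by metis
  have "box_choosable TYPE('c) n1 n2 m n" if ch: "box_choosable TYPE('c) a 1 m n" for m n
  proof (rule region_choosable, rule choosable_transfer[OF ch])
    have "f p < a" if "p \<in> ?T" for p
      using bij_betwE[OF bij] that by auto
    moreover have "inv_into ?T f x \<in> ?T" if "x < a" for x
      using bij that by (metis bij_betw_def inv_into_into lessThan_iff)
    ultimately show "bij_betw (\<lambda>((p, k), t). (((f p, 0), k), t)) (region ?T m n) (region ({..<a} \<times> {..<1}) m n)"
      by (intro bij_betw_byWitness[where f' = "\<lambda>(((x, _), k), t). ((inv_into ?T f x, k), t)"])
        (auto simp: region_def bij_betw_inv_into_left[OF bij] bij_betw_inv_into_right[OF bij])
    show "finite (region ?T m n)"
      using bij bij_betw_finite[of f ?T "{..<a}"] by (auto simp: region_def)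
    show "grid_adj ((\<lambda>((p, k), t). (((f p, 0), k), t)) x) ((\<lambda>((p, k), t). (((f p, 0), k), t)) y)"
      if x_in: "x \<in> region ?T m n" and y_in: "y \<in> region ?T m n" and xy: "grid_adj x y" for x y
    proof -
      obtain i j k t where x: "x = (((i, j), k), t)" "(i, j) \<in> ?T"
        using x_in by (auto simp: region_def)
      obtain i' j' k' t' where y: "y = (((i', j'), k'), t')" "(i', j') \<in> ?T"
        using y_in by (auto simp: region_def)
      show ?thesis
        using xy f1[of i j] f1[of i' j'] f2[of i j] f2[of i' j'] x(2) y(2) unfolding x(1) y(1)
        by auto
    qed
  qed
  then show ?thesis by blast
qed

lemma box_choosable_permute:
  assumes "box_choosable TYPE('c) n3 n4 n1 n2"
  shows "box_choosable TYPE('c) n1 n2 n3 n4"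
proof (rule choosable_transfer[OF assms])
  show "bij_betw (\<lambda>(((i, j), k), t). (((k, t), i), j)) (region ({..<n1} \<times> {..<n2}) n3 n4) (region ({..<n3} \<times> {..<n4}) n1 n2)"
    by (intro bij_betw_byWitness[where f' = "\<lambda>(((i, j), k), t). (((k, t), i), j)"]) (auto simp: region_def)
qed (auto simp: region_def)

lemma box_choosable_permute2:
  assumes "box_choosable TYPE('c) n1 n3 n2 n4"
  shows "box_choosable TYPE('c) n1 n2 n3 n4"
proof (rule choosable_transfer[OF assms])
  show "bij_betw (\<lambda>(((i, j), k), t). (((i, k), j), t)) (region ({..<n1} \<times> {..<n2}) n3 n4) (region ({..<n1} \<times> {..<n3}) n2 n4)"
    by (intro bij_betw_byWitness[where f' = "\<lambda>(((i, j), k), t). (((i, k), j), t)"]) (auto simp: region_def)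
qed (auto simp: region_def)

text \<open>Blocks of four consecutive vertices get different colours greedily; the only earlier
  neighbour that \<open>v\<close> can have outside its block is \<open>v - 1\<close>.\<close>

lemma path_choosable: "choosable TYPE('c) (\<lambda>i j. i = Suc j \<or> j = Suc i) {..<a::nat}"
  unfolding choosable_def
proof (intro allI impI)
  fix L :: "nat \<Rightarrow> 'c set" assume "\<forall>v\<in>{..<a}. card (L v) = 4"
  then show "\<exists>c. good (\<lambda>i j. i = Suc j \<or> j = Suc i) L {..<a} c"
  proof (induction a rule: less_induct)
    case (less a)
    \<comment> \<open>Truncated subtraction: for \<open>a < 4\<close> the block is the whole
      path.\<close>
    define b where "b = a - 4"
    have "\<exists>c. good (\<lambda>i j. i = Suc j \<or> j = Suc i) L {..<b} c"
    proof (cases "a = 0")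
      case True
      then show ?thesis by (simp add: b_def good_empty)
    next
      case False
      then show ?thesis using less by (intro less.IH) (auto simp: b_def)
    qed
    then obtain c where c: "good (\<lambda>i j. i = Suc j \<or> j = Suc i) L {..<b} c" by blast
    have "\<exists>g. inj_on g {b..<d} \<and> (\<forall>i\<in>{b..<d}. g i \<in> L i)" if "b \<le> d" "d \<le> a" for d
      using that
    proof (induction d rule: dec_induct)
      case base
      then show ?case by auto
    next
      case (step d)
      then obtain g where g: "inj_on g {b..<d}" "\<forall>i\<in>{b..<d}. g i \<in> L i" by auto
      have "card (g ` {b..<d}) \<le> d - b"
        using card_image_le[of "{b..<d}" g] by simp
      then have "card (g ` {b..<d}) < card (L d)"
        using step less.prems by (auto simp: b_def)
      then obtain y where "y \<in> L d" "y \<notin> g ` {b..<d}"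
        by (meson card_mono finite_atLeastLessThan finite_imageI not_le subsetI)
      moreover have "{b..<Suc d} = insert d {b..<d}"
        using step by auto
      ultimately show ?case
        using g by (intro exI[of _ "g(d := y)"]) (auto simp: inj_on_def)
    qed
    from this[of a] obtain g where g: "inj_on g {b..<a}" "\<forall>i\<in>{b..<a}. g i \<in> L i"
      by (auto simp: b_def)
    define c' where "c' i = (if i < b then c i else g i)" for i
    have "good (\<lambda>i j. i = Suc j \<or> j = Suc i) L ({..<b} \<union> {b..<a}) c'"
    proof (rule good_block)
      show "good (\<lambda>i j. i = Suc j \<or> j = Suc i) L {..<b} c'"
        using c by (rule good_cong) (simp add: c'_def)
      show "card {b..<a} = 4 \<or> {..<b} = {} \<and> card {b..<a} \<le> 4"
        by (auto simp: b_def)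
      show "inj_on c' {b..<a}"
        using g(1) by (auto simp: inj_on_def c'_def)
      fix v assume v: "v \<in> {b..<a}"
      have "{u \<in> {..<b}. (v = Suc u \<or> u = Suc v) \<and> c' u = c' v} \<subseteq> {v - 1}"
        using v by auto
      then have "card {u \<in> {..<b}. (v = Suc u \<or> u = Suc v) \<and> c' u = c' v} \<le> card {v - 1}"
        by (intro card_mono) auto
      then show "c' v \<in> L v \<and> \<not> (v = Suc v \<or> v = Suc v) \<and>
        card {u \<in> {..<b}. (v = Suc u \<or> u = Suc v) \<and> c' u = c' v} \<le> 1"
        using g(2) v by (auto simp: c'_def)
    qed auto
    moreover have "{..<b} \<union> {b..<a} = {..<a}" by (auto simp: b_def)
    ultimately show ?case by auto
  qed
qed

lemma box_choosable_path: "box_choosable TYPE('c) a 1 1 1"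
proof (rule choosable_transfer[OF path_choosable])
  show "bij_betw (fst \<circ> fst \<circ> fst) (region ({..<a} \<times> {..<1}) 1 1) {..<a}"
    by (intro bij_betw_byWitness[where f' = "\<lambda>i. (((i, 0), 0), 0)"]) (auto simp: region_def)
qed (auto simp: region_def)

text \<open>Each reduction replaces two dimensions by one and a factor \<open>1\<close>: first
  \<open>n1\<close>, \<open>n2\<close> by \<open>a\<close>, then \<open>n3\<close>,
  \<open>n4\<close> by \<open>b\<close>, and finally \<open>b\<close>, \<open>a\<close> by
  \<open>d\<close>.\<close>

theorem box_choosable: "box_choosable TYPE('c) n1 n2 n3 n4"
proof -
  obtain a where a: "\<And>m n. box_choosable TYPE('c) a 1 m n \<Longrightarrow> box_choosable TYPE('c) n1 n2 m n"
    using box_choosable_reduce[where 'c = 'c] by blast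
  obtain b where b: "\<And>m n. box_choosable TYPE('c) b 1 m n \<Longrightarrow> box_choosable TYPE('c) n3 n4 m n"
    using box_choosable_reduce[where 'c = 'c] by blast
  obtain d where d: "\<And>m n. box_choosable TYPE('c) d 1 m n \<Longrightarrow> box_choosable TYPE('c) b a m n"
    using box_choosable_reduce[where 'c = 'c] by blast
  have "box_choosable TYPE('c) b a 1 1"
    by (rule d) (rule box_choosable_path)
  then have "box_choosable TYPE('c) n3 n4 a 1"
    by (rule b[OF box_choosable_permute2])
  then show ?thesis
    by (rule a[OF box_choosable_permute])
qed

section \<open>Acyclicity and the main theorem\<close>

context pre_digraph
begin

lemma cas_awalk_verts: "cas u p v \<Longrightarrow> awalk_verts u p = u # map (head G) p"
  by (induction p arbitrary: u) auto

lemma cas_last: "cas u p v \<Longrightarrow> p \<noteq> [] \<Longrightarrow> head G (last p) = v"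
  by (induction p arbitrary: u) auto

lemma cas_nth: "cas u p v \<Longrightarrow> i < length p \<Longrightarrow> tail G (p ! i) = (if i = 0 then u else head G (p ! (i - 1)))"
proof (induction p arbitrary: u i)
  case (Cons e p)
  then show ?case by (cases i) auto
qed simp

end

text \<open>The cyclic predecessor and successor of a vertex are adjacent to it, and they differ
  because the length is at least three.\<close>

lemma cycle_two_neighbours:
  assumes "pre_digraph.cycle H p" "3 \<le> length p" and sym: "\<And>e. e \<in> arcs H \<Longrightarrow> adj (tail H e) (head H e) \<and> adj (head H e) (tail H e)"
    and v: "v \<in> head H ` set p"
  shows "2 \<le> card {u \<in> head H ` set p. adj v u}"
proof -
  interpret pre_digraph H .
  obtain u where aw: "awalk u p u" and dist: "distinct (tl (awalk_verts u p))" and "p \<noteq> []"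
    using assms(1) unfolding cycle_def by blast
  have cas: "cas u p u" and arcs: "set p \<subseteq> arcs H"
    using aw by (auto simp: awalk_def)
  define l where "l = length p"
  define h where "h i = head H (p ! i)" for i
  have l: "l \<ge> 3" using assms(2) by (simp add: l_def)
  \<comment> \<open>Dropping the first vertex of the walk, which recurs at its end, leaves the heads
    of the arcs.\<close>
  have dist: "distinct (map (head H) p)"
    using dist cas_awalk_verts[OF cas] by simp
  have inj: "h i = h j \<longleftrightarrow> i = j" if "i < l" "j < l" for i j
    using nth_eq_iff_index_eq[OF dist, of i j] that by (simp add: h_def l_def)
  have u: "u = h (l - 1)"
    using cas_last[OF cas \<open>p \<noteq> []\<close>] \<open>p \<noteq> []\<close> by (simp add: h_def l_def last_conv_nth)
  have adj: "adj (h j) (h i) \<and> adj (h i) (h j)" if "i < l" "j = (if i = 0 then l - 1 else i - 1)" for i j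
  proof -
    have "tail H (p ! i) = h j"
      using cas_nth[OF cas, of i] that u by (auto simp: l_def h_def)
    moreover have "p ! i \<in> arcs H"
      using arcs that(1) by (auto simp: l_def)
    ultimately show ?thesis
      using sym[of "p ! i"] by (simp add: h_def)
  qed
  obtain i where i: "i < l" "v = h i"
    using v by (auto simp: in_set_conv_nth l_def h_def)
  define j where "j = (if i = 0 then l - 1 else i - 1)"
  define k where "k = (if i = l - 1 then 0 else Suc i)"
  have jk: "j < l" "k < l" "j \<noteq> k" "i = (if k = 0 then l - 1 else k - 1)"
    using i l by (auto simp: j_def k_def)
  have "adj v (h j)" "adj v (h k)"
    using adj[OF i(1) j_def] adj[OF jk(2,4)] i(2) by auto
  moreover have "h j \<in> head H ` set p" "h k \<in> head H ` set p"
    using jk by (auto simp: h_def l_def)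
  ultimately have "{h j, h k} \<subseteq> {u \<in> head H ` set p. adj v u}"
    by blast
  then have "card {h j, h k} \<le> card {u \<in> head H ` set p. adj v u}"
    by (intro card_mono) auto
  then show ?thesis
    using jk inj[of j k] by simp
qed

lemma pverts_grid: "pverts (path_graph n1 \<box> path_graph n2 \<box> path_graph n3 \<box> path_graph n4) =
    region ({..<n1} \<times> {..<n2}) n3 n4"
  by (simp add: cart_prod_def path_graph_def region_def)

lemma parcs_grid: "(u, v) \<in> parcs (path_graph n1 \<box> path_graph n2 \<box> path_graph n3 \<box> path_graph n4) \<Longrightarrow>
    grid_adj u v \<and> grid_adj v u"
  by (auto simp: cart_prod_def path_graph_def)

theorem theorem12:
  fixes n1 n2 n3 n4 :: nat
  assumes "n1 \<ge> 2" "n2 \<ge> 2" "n3 \<ge> 2" "n4 \<ge> 2"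
  shows "equitably_list_arborable TYPE('c) 4
    (path_graph n1 \<box> path_graph n2 \<box> path_graph n3 \<box> path_graph n4)"
proof -
  let ?G = "path_graph n1 \<box> path_graph n2 \<box> path_graph n3 \<box> path_graph n4"
  let ?V = "region ({..<n1} \<times> {..<n2}) n3 n4"
  have "\<exists>c. list_colouring ?G L c \<and> equitable_colouring 4 ?G c \<and>
      (\<forall>x. acyclic_graph (with_proj ?G \<restriction> colour_class ?G c x))"
    if "uniform_list_assignment 4 ?G L" for L :: "_ \<Rightarrow> 'c set"
  proof -
    have "\<forall>v\<in>?V. card (L v) = 4"
      using that by (simp add: uniform_list_assignment_def pverts_grid)
    then obtain c where c: "good grid_adj L ?V c"
      using box_choosable[of n1 n2 n3 n4, where 'c = 'c] unfolding choosable_def by blast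
    have "list_colouring ?G L c"
      using good_list[OF c] by (simp add: list_colouring_def pverts_grid)
    moreover have "equitable_colouring 4 ?G c"
      unfolding equitable_colouring_def colour_class_def pverts_grid
    proof
      fix x
      have "card {v \<in> ?V. c v = x} \<le> (card ?V + 3) div 4"
        by (rule good_count[OF c])
      then show "int (card {v \<in> ?V. c v = x}) \<le> \<lceil>real (card ?V) / real 4\<rceil>"
        by linarith
    qed
    moreover have "acyclic_graph (with_proj ?G \<restriction> colour_class ?G c x)" for x
      unfolding acyclic_graph_def
    proof
      let ?H = "with_proj ?G \<restriction> colour_class ?G c x"
      assume "\<exists>p. pre_digraph.cycle ?H p \<and> 3 \<le> length p"
      then obtain p where p: "pre_digraph.cycle ?H p" "3 \<le> length p" by blast
      \<comment> \<open>The vertices of the cycle have one colour, and each has two neighbours among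
        them, contrary to sparseness.\<close>
      let ?U = "head ?H ` set p"
      have arcs: "set p \<subseteq> arcs ?H"
        using p(1) by (auto simp: pre_digraph.cycle_def pre_digraph.awalk_def)
      have U: "?U \<subseteq> colour_class ?G c x"
        using arcs by (auto simp: induce_subgraph_def)
      have "?U \<subseteq> ?V"
        using U by (auto simp: colour_class_def pverts_grid)
      moreover have "?U \<noteq> {}" using p(2) by auto
      moreover have "c u = c v" if "u \<in> ?U" "v \<in> ?U" for u v
        using U that by (auto simp: colour_class_def)
      ultimately obtain v where v: "v \<in> ?U" "card {u \<in> ?U. grid_adj v u} \<le> 1"
        using good_sparse[OF c, of ?U] by blast
      have "grid_adj (tail ?H e) (head ?H e) \<and> grid_adj (head ?H e) (tail ?H e)" if "e \<in> arcs ?H" for e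
        using that parcs_grid[of "fst e" "snd e" n1 n2 n3 n4] by (auto simp: induce_subgraph_def)
      then have "2 \<le> card {u \<in> ?U. grid_adj v u}"
        by (rule cycle_two_neighbours[OF p _ v(1)])
      then show False using v(2) by simp
    qed
    ultimately show ?thesis by blast
  qed
  then show ?thesis
    by (simp add: equitably_list_arborable_def)
qed

end
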